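(* Let $E,A\in\mathbb{R}^{n\times n}$ with $E^\top=E\ge0$ and $A=-A^\top$, and assume that $\{E,A\}$ is a regular matrix pencil, i.e., the null spaces satisfy $\mathcal{N}(E)\cap\mathcal{N}(A)=\{0\}$. Then the generalized Cayley transform $C(E,A)=(E-A)^{-1}(E+A)$ satisfies $$\|C(E,A)x\|_E=\|x\|_E\quad\text{for all }x\in\mathbb{R}^n,$$ where $\|x\|_E=\langle x,x\rangle_E^{1/2}$ and $\langle x,y\rangle_E=y^\top Ex$.
   Context: $E\ge0$ means positive semi-definite; $\mathcal{N}(M)$ is the null space of $M$. For $E,A\in\mathbb{R}^{n\times n}$ with $E-A$ non-singular, the generalized Cayley transform is $C(E,A):=(E-A)^{-1}(E+A)$. *)

theory Defs
  imports "HOL-Analysis.Analysis"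
begin

definition pos_semidef :: "real ^ 'n ^ 'n \<Rightarrow> bool" where
  "pos_semidef E \<longleftrightarrow> (\<forall>x. 0 \<le> x \<bullet> (E *v x))"

definition null_space :: "real ^ 'n ^ 'm \<Rightarrow> (real ^ 'n) set" where
  "null_space M = {x. M *v x = 0}"

text \<open>Regularity of a pencil is taken here in the null-space form, for a pair with
  \<open>E\<close> symmetric positive semi-definite and \<open>A\<close> skew-symmetric. For arbitrary pairs this
  condition is weaker than \<open>det (c E - A)\<close> not vanishing identically in \<open>c\<close>.\<close>

definition regular_pencil :: "real ^ 'n ^ 'n \<Rightarrow> real ^ 'n ^ 'n \<Rightarrow> bool" where
  "regular_pencil E A \<longleftrightarrow> null_space E \<inter> null_space A = {0}"

text \<open>Meaningful only if \<open>E - A\<close> is invertible: otherwise \<open>matrix_inv\<close> is unspecified.\<close>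

definition cayley :: "real ^ 'n ^ 'n \<Rightarrow> real ^ 'n ^ 'n \<Rightarrow> real ^ 'n ^ 'n" where
  "cayley E A = matrix_inv (E - A) ** (E + A)"

definition inner_wrt :: "real ^ 'n ^ 'n \<Rightarrow> real ^ 'n \<Rightarrow> real ^ 'n \<Rightarrow> real" where
  "inner_wrt E x y = y \<bullet> (E *v x)"

definition norm_wrt :: "real ^ 'n ^ 'n \<Rightarrow> real ^ 'n \<Rightarrow> real" where
  "norm_wrt E x = sqrt (inner_wrt E x x)"

end

theory Submission
  imports Defs
begin

text \<open>
  Write \<open>y = C(E,A) x\<close>. Once \<open>E - A\<close> is known to be invertible, this means
  \<open>(E - A) y = (E + A) x\<close>, that is, \<open>E (y - x) = A (y + x)\<close>. Pairing both sides with \<open>y + x\<close>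
  annihilates the right-hand side, because \<open>A\<close> is skew-symmetric, while the symmetry of \<open>E\<close>
  turns the left-hand side into the difference of the two squared \<open>E\<close>-norms,
  \<open>y \<bullet> E y - x \<bullet> E x\<close>. Hence the norms agree.

  For the invertibility, let \<open>E x = A x\<close>. Pairing with \<open>x\<close> gives \<open>x \<bullet> E x = x \<bullet> A x = 0\<close>.
  A null vector of a semidefinite symmetric form is in its kernel, so \<open>E x = 0\<close>, hence also
  \<open>A x = 0\<close>, and regularity of the pencil forces \<open>x = 0\<close>.
\<close>

lemma skew_quadratic_form_eq_0:
  fixes A :: "real ^ 'n ^ 'n"
  assumes "A = - transpose A"
  shows "x \<bullet> (A *v x) = 0"
proof -
  have "x \<bullet> (A *v x) = x \<bullet> ((0 - transpose A) *v x)"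
    using assms by simp
  also have "\<dots> = - (x \<bullet> (transpose A *v x))"
    by (simp only: matrix_vector_mult_diff_rdistrib) simp
  also have "x \<bullet> (transpose A *v x) = x \<bullet> (A *v x)"
    by (metis dot_lmul_matrix inner_commute transpose_matrix_vector)
  finally have "x \<bullet> (A *v x) = - (x \<bullet> (A *v x))" .
  then show ?thesis by simp
qed

lemma symmetric_matrix_inner_swap:
  fixes E :: "real ^ 'n ^ 'n"
  assumes "transpose E = E"
  shows "x \<bullet> (E *v y) = y \<bullet> (E *v x)"
  by (metis assms dot_lmul_matrix inner_commute transpose_matrix_vector)

text \<open>
  If \<open>x \<bullet> E x = 0\<close> then \<open>a x - b E x\<close> has the quadratic form value
  \<open>- 2 a b |E x|\<^sup>2 + b\<^sup>2 c\<close> with \<open>c = E x \<bullet> E (E x)\<close>, which becomes negative for suitable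
  \<open>a\<close> and \<open>b\<close> unless \<open>E x = 0\<close>.
\<close>

lemma pos_semidef_null_vector:
  fixes E :: "real ^ 'n ^ 'n"
  assumes sym: "transpose E = E" and psd: "pos_semidef E"
    and null: "x \<bullet> (E *v x) = 0"
  shows "E *v x = 0"
proof -
  define z s c where "z = E *v x" and "s = z \<bullet> z" and "c = z \<bullet> (E *v z)"
  have c: "c \<ge> 0"
    using psd by (simp add: pos_semidef_def c_def)
  have xz: "x \<bullet> (E *v z) = s"
    using symmetric_matrix_inner_swap[OF sym, of x z] by (simp add: s_def z_def)
  have zx: "z \<bullet> (E *v x) = s"
    by (simp add: s_def z_def)
  \<comment> \<open>The weights \<open>c + 1\<close> and \<open>s\<close> make the value a negative multiple of \<open>s\<^sup>2\<close>.\<close>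
  have "0 \<le> ((c + 1) *\<^sub>R x - s *\<^sub>R z) \<bullet> (E *v ((c + 1) *\<^sub>R x - s *\<^sub>R z))"
    using psd by (simp add: pos_semidef_def)
  also have "\<dots> = - (c + 2) * s\<^sup>2"
    by (simp add: matrix_vector_mult_diff_distrib matrix_vector_mult_scaleR inner_diff_left
        inner_diff_right null xz zx c_def[symmetric])
      (simp add: algebra_simps power2_eq_square)
  finally have "(c + 2) * s\<^sup>2 \<le> 0"
    by (simp add: algebra_simps)
  then have "s = 0"
    using c by (simp add: mult_le_0_iff)
  then show ?thesis
    by (simp add: s_def z_def)
qed

lemma invertible_diff_of_regular_pencil:
  fixes E A :: "real ^ 'n ^ 'n"
  assumes sym: "transpose E = E" and psd: "pos_semidef E"
    and skew: "A = - transpose A" and reg: "regular_pencil E A"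
  shows "invertible (E - A)"
proof -
  have "x = 0" if "(E - A) *v x = 0" for x
  proof -
    have eq: "E *v x = A *v x"
      using that by (simp add: matrix_vector_mult_diff_rdistrib)
    then have "x \<bullet> (E *v x) = 0"
      using skew_quadratic_form_eq_0[OF skew] by simp
    then have "E *v x = 0"
      by (rule pos_semidef_null_vector[OF sym psd])
    with eq have "x \<in> null_space E \<inter> null_space A"
      by (simp add: null_space_def)
    then show "x = 0"
      using reg by (auto simp only: regular_pencil_def)
  qed
  then show ?thesis
    by (simp add: invertible_left_inverse matrix_left_invertible_ker)
qed

lemma cayley_equation:
  fixes E A :: "real ^ 'n ^ 'n"
  assumes "invertible (E - A)"
  shows "(E - A) *v (cayley E A *v x) = (E + A) *v x"
proof -
  have "(E - A) ** matrix_inv (E - A) = mat 1"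
    using assms unfolding invertible_def matrix_inv_def by (rule someI2_ex) simp
  then have "(E - A) ** cayley E A = E + A"
    by (simp add: cayley_def matrix_mul_assoc)
  then show ?thesis
    by (simp add: matrix_vector_mul_assoc)
qed

theorem lemma4p5:
  fixes E A :: "real ^ 'n ^ 'n"
  assumes "transpose E = E" and "pos_semidef E"
    and "A = - transpose A"
    and "regular_pencil E A"
  shows "invertible (E - A) \<and> (\<forall>x. norm_wrt E (cayley E A *v x) = norm_wrt E x)"
proof (intro conjI allI)
  show inv: "invertible (E - A)"
    using assms by (rule invertible_diff_of_regular_pencil)
  fix x :: "real ^ 'n"
  define y where "y = cayley E A *v x"
  have "(E - A) *v y = (E + A) *v x"
    unfolding y_def using inv by (rule cayley_equation)
  then have "E *v (y - x) = A *v (y + x)"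
    by (simp add: matrix_vector_mult_diff_rdistrib matrix_vector_mult_add_rdistrib
        matrix_vector_mult_diff_distrib matrix_vector_right_distrib algebra_simps)
  then have "(y + x) \<bullet> (E *v (y - x)) = 0"
    using skew_quadratic_form_eq_0[OF assms(3)] by simp
  then have "y \<bullet> (E *v y) = x \<bullet> (E *v x)"
    using symmetric_matrix_inner_swap[OF assms(1), of x y]
    by (simp add: matrix_vector_mult_diff_distrib inner_add_left inner_diff_right)
  then show "norm_wrt E (cayley E A *v x) = norm_wrt E x"
    by (simp add: norm_wrt_def inner_wrt_def y_def)
qed

end
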